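(* Let $\Omega\subset\mathbb{C}$ be a simply connected domain and let $f=h+\overline{g}$ be a sense-preserving harmonic mapping in $\Omega$. Consider the affine harmonic mapping $A(z)=az+b\overline{z}+c$ with $a,b,c\in\mathbb{C}$ and $|a|\neq|b|$. Then $P_{(A\circ f)}\equiv P_f$ and $S_{(A\circ f)}\equiv S_f$ in $\Omega$.
   Context: A complex-valued harmonic function $f$ in a simply connected domain $\Omega$ is written $f=h+\overline{g}$ with $h,g$ analytic in $\Omega$. It is locally univalent iff its Jacobian $J_f=|h'|^2-|g'|^2$ does not vanish in $\Omega$; it is called sense-preserving if $J_f>0$ in $\Omega$ and sense-reversing if $J_f<0$ in $\Omega$ (then $\overline{f}$ is sense-preserving). For sense-preserving $f$, $h'\neq 0$ and the dilatation $\omega=\omega_f=g'/h'$ is analytic with $|\omega|<1$. For sense-preserving $f$, the pre-Schwarzian derivative is $$P_f=\frac{\partial}{\partial z}\log J_f=\frac{h''}{h'}-\frac{\overline{\omega}\,\omega'}{1-|\omega|^2}$$ and the Schwarzian derivative is $$S_f=\frac{\partial P_f}{\partial z}-\frac12 P_f^2=Sh+\frac{\overline{\omega}}{1-|\omega|^2}\left(\frac{h''}{h'}\,\omega'-\omega''\right)-\frac32\left(\frac{\omega'\,\overline{\omega}}{1-|\omega|^2}\right)^2,$$ where $Sh=(h''/h')'-\frac12(h''/h')^2$ is the classical Schwarzian derivative and $\partial/\partial z=\frac12(\partial/\partial x-i\,\partial/\partial y)$. For sense-reversing $f$, $P_f:=P_{\overline{f}}$ and $S_f:=S_{\overline{f}}$.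 *)

theory Defs
  imports "HOL-Analysis.Analysis"
begin

definition harmonic_decomp ::
  "complex set \<Rightarrow> (complex \<Rightarrow> complex) \<Rightarrow> (complex \<Rightarrow> complex) \<Rightarrow> (complex \<Rightarrow> complex) \<Rightarrow> bool"
  where "harmonic_decomp \<Omega> f h g \<longleftrightarrow>
    h holomorphic_on \<Omega> \<and> g holomorphic_on \<Omega> \<and> (\<forall>z\<in>\<Omega>. f z = h z + cnj (g z))"

text \<open>
  The pair \<open>(h, g)\<close> is determined only up to an additive constant, but the derivatives of
  \<open>h\<close> and \<open>g\<close> are determined by \<open>f\<close>, so that the description below picks out a unique number;
  see \<open>jacobian_eq\<close>.
\<close>

definition jacobian :: "complex set \<Rightarrow> (complex \<Rightarrow> complex) \<Rightarrow> complex \<Rightarrow> real"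
  where "jacobian \<Omega> f z =
    (THE J. \<exists>h g. harmonic_decomp \<Omega> f h g \<and> J = (norm (deriv h z))\<^sup>2 - (norm (deriv g z))\<^sup>2)"

lemma harmonic_decomp_deriv_unique:
  assumes "open \<Omega>" "z \<in> \<Omega>" "harmonic_decomp \<Omega> f h g" "harmonic_decomp \<Omega> f H G"
  shows "deriv h z = deriv H z" and "deriv g z = deriv G z"
proof -
  define p q where "p = deriv h z - deriv H z" and "q = deriv G z - deriv g z"
  have fd: "h field_differentiable at z" "g field_differentiable at z"
    "H field_differentiable at z" "G field_differentiable at z"
    using assms by (auto simp: harmonic_decomp_def holomorphic_on_imp_differentiable_at)
  have u: "((\<lambda>w. h w - H w) has_field_derivative p) (at z)"
    unfolding p_def using fd by (intro DERIV_diff) (simp_all add: DERIV_deriv_iff_field_differentiable)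
  have v: "((\<lambda>w. G w - g w) has_field_derivative q) (at z)"
    unfolding q_def using fd by (intro DERIV_diff) (simp_all add: DERIV_deriv_iff_field_differentiable)
  have u': "((\<lambda>w. h w - H w) has_derivative (\<lambda>t. p * t)) (at z)"
    using u by (simp add: has_field_derivative_def)
  have "((\<lambda>w. cnj (G w - g w)) has_derivative (\<lambda>t. cnj (q * t))) (at z)"
    using v by (intro has_derivative_cnj) (simp add: has_field_derivative_def)
  moreover have "cnj (G w - g w) = h w - H w" if "w \<in> \<Omega>" for w
  proof -
    have "h w + cnj (g w) = H w + cnj (G w)"
      using assms that by (metis harmonic_decomp_def)
    then show ?thesis by (simp add: algebra_simps)
  qed
  ultimately have "((\<lambda>w. h w - H w) has_derivative (\<lambda>t. cnj (q * t))) (at z)"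
    using assms(1,2) by (blast intro: has_derivative_transform_within_open)
  then have eq: "(\<lambda>t. p * t) = (\<lambda>t. cnj (q * t))"
    using u' has_derivative_unique by blast
  have "p = cnj q" "p * \<i> = - (cnj q * \<i>)"
    using fun_cong[OF eq, of 1] fun_cong[OF eq, of \<i>] by simp_all
  then have "p = 0" "q = 0" by (auto simp: complex_eq_iff)
  then show "deriv h z = deriv H z" "deriv g z = deriv G z"
    by (simp_all add: p_def q_def)
qed

lemma jacobian_eq:
  assumes "open \<Omega>" "z \<in> \<Omega>" "harmonic_decomp \<Omega> f h g"
  shows "jacobian \<Omega> f z = (norm (deriv h z))\<^sup>2 - (norm (deriv g z))\<^sup>2"
  unfolding jacobian_def
proof (rule the_equality)
  fix J assume "\<exists>H G. harmonic_decomp \<Omega> f H G \<and> J = (norm (deriv H z))\<^sup>2 - (norm (deriv G z))\<^sup>2"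
  then show "J = (norm (deriv h z))\<^sup>2 - (norm (deriv g z))\<^sup>2"
    using harmonic_decomp_deriv_unique[OF assms] by auto
qed (use assms in blast)

definition sense_preserving :: "complex set \<Rightarrow> (complex \<Rightarrow> complex) \<Rightarrow> bool"
  where "sense_preserving \<Omega> f \<longleftrightarrow>
    (\<exists>h g. harmonic_decomp \<Omega> f h g) \<and> (\<forall>z\<in>\<Omega>. jacobian \<Omega> f z > 0)"

definition sense_reversing :: "complex set \<Rightarrow> (complex \<Rightarrow> complex) \<Rightarrow> bool"
  where "sense_reversing \<Omega> f \<longleftrightarrow>
    (\<exists>h g. harmonic_decomp \<Omega> f h g) \<and> (\<forall>z\<in>\<Omega>. jacobian \<Omega> f z < 0)"

definition wirtinger_dz :: "(complex \<Rightarrow> complex) \<Rightarrow> complex \<Rightarrow> complex"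
  where "wirtinger_dz F z =
    (vector_derivative (\<lambda>x. F (Complex x (Im z))) (at (Re z))
      - \<i> * vector_derivative (\<lambda>y. F (Complex (Re z) y)) (at (Im z))) / 2"

definition pre_schwarzian_sp :: "complex set \<Rightarrow> (complex \<Rightarrow> complex) \<Rightarrow> complex \<Rightarrow> complex"
  where "pre_schwarzian_sp \<Omega> f = wirtinger_dz (\<lambda>w. complex_of_real (ln (jacobian \<Omega> f w)))"

definition schwarzian_sp :: "complex set \<Rightarrow> (complex \<Rightarrow> complex) \<Rightarrow> complex \<Rightarrow> complex"
  where "schwarzian_sp \<Omega> f z =
    wirtinger_dz (pre_schwarzian_sp \<Omega> f) z - (pre_schwarzian_sp \<Omega> f z)\<^sup>2 / 2"

text \<open>
  The suffix \<open>_sp\<close> marks the operators that are meaningful for sense-preserving functions only.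
  Those without it also cover sense-reversing functions, through the conjugate function, and
  are left unspecified when the Jacobian is not of one strict sign on \<open>\<Omega>\<close>.
\<close>

definition pre_schwarzian :: "complex set \<Rightarrow> (complex \<Rightarrow> complex) \<Rightarrow> complex \<Rightarrow> complex"
  where "pre_schwarzian \<Omega> f =
    (if sense_preserving \<Omega> f then pre_schwarzian_sp \<Omega> f
     else if sense_reversing \<Omega> f then pre_schwarzian_sp \<Omega> (cnj \<circ> f)
     else undefined)"

definition schwarzian :: "complex set \<Rightarrow> (complex \<Rightarrow> complex) \<Rightarrow> complex \<Rightarrow> complex"
  where "schwarzian \<Omega> f =
    (if sense_preserving \<Omega> f then schwarzian_sp \<Omega> f
     else if sense_reversing \<Omega> f then schwarzian_sp \<Omega> (cnj \<circ> f)
     else undefined)"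

definition affine_harmonic :: "complex \<Rightarrow> complex \<Rightarrow> complex \<Rightarrow> complex \<Rightarrow> complex"
  where "affine_harmonic a b c z = a * z + b * cnj z + c"

end

theory Submission
  imports Defs
begin

text \<open>
  If \<open>f = h + cnj g\<close>, then \<open>A \<circ> f\<close> has analytic part \<open>a h + b g + c\<close> and co-analytic part
  \<open>cnj a g + cnj b h\<close>, so that composing with \<open>A\<close> multiplies the Jacobian by the real determinant
  \<open>(norm a)\<^sup>2 - (norm b)\<^sup>2\<close> of the linear part of \<open>A\<close> (\<open>jacobian_affine_comp\<close>). When that determinant is
  positive, \<open>ln J\<close> changes by an additive constant, which the Wirtinger derivative does not see;
  hence \<open>P\<^sub>f\<close>, and with it \<open>S\<^sub>f\<close>, is unchanged.

  When the determinant is negative, \<open>A \<circ> f\<close> is sense-reversing, and both operators are by definition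
  evaluated on \<open>cnj \<circ> A \<circ> f\<close>. The conjugate of an affine harmonic mapping is the affine harmonic
  mapping with coefficients \<open>cnj b\<close>, \<open>cnj a\<close>, \<open>cnj c\<close>, whose determinant is positive, which reduces
  this case to the first one.
\<close>

lemma harmonic_decomp_affine_comp:
  assumes "harmonic_decomp \<Omega> f h g"
  shows "harmonic_decomp \<Omega> (affine_harmonic a b c \<circ> f)
           (\<lambda>w. a * h w + b * g w + c) (\<lambda>w. cnj a * g w + cnj b * h w)"
  using assms unfolding harmonic_decomp_def affine_harmonic_def
  by (auto intro!: holomorphic_intros simp: algebra_simps)

lemma cnj_comp_affine_harmonic:
  "cnj \<circ> affine_harmonic a b c = affine_harmonic (cnj b) (cnj a) (cnj c)"
  by (auto simp: affine_harmonic_def fun_eq_iff)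

text \<open>
  Multiplicativity of the real Jacobian determinant, expressed through the coefficients of
  \<open>t \<mapsto> a t + b cnj t\<close> and \<open>t \<mapsto> p t + cnj (q t)\<close>: the cross terms of the two squares on the left
  cancel.
\<close>

lemma norm_square_diff_affine:
  fixes a b p q :: complex
  shows "(norm (a * p + b * q))\<^sup>2 - (norm (cnj a * q + cnj b * p))\<^sup>2 =
    ((norm a)\<^sup>2 - (norm b)\<^sup>2) * ((norm p)\<^sup>2 - (norm q)\<^sup>2)"
  unfolding cmod_power2 by (simp add: power2_eq_square algebra_simps)

lemma jacobian_affine_comp:
  assumes "open \<Omega>" "z \<in> \<Omega>" "harmonic_decomp \<Omega> f h g"
  shows "jacobian \<Omega> (affine_harmonic a b c \<circ> f) z =
    ((norm a)\<^sup>2 - (norm b)\<^sup>2) * jacobian \<Omega> f z"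
proof -
  have "(h has_field_derivative deriv h z) (at z)" "(g has_field_derivative deriv g z) (at z)"
    using assms by (auto simp: harmonic_decomp_def intro: holomorphic_derivI)
  then have "deriv (\<lambda>w. a * h w + b * g w + c) z = a * deriv h z + b * deriv g z"
    and "deriv (\<lambda>w. cnj a * g w + cnj b * h w) z = cnj a * deriv g z + cnj b * deriv h z"
    by (auto intro!: DERIV_imp_deriv derivative_eq_intros)
  then show ?thesis
    using jacobian_eq[OF assms(1,2) harmonic_decomp_affine_comp[OF assms(3)], of a b c]
      jacobian_eq[OF assms] norm_square_diff_affine[of a "deriv h z" b "deriv g z"]
    by simp
qed

text \<open>
  The two functions have the same derivatives in the sense of \<open>has_vector_derivative\<close>, hence the
  same chosen value of \<open>vector_derivative\<close> even at a point where neither is differentiable.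
\<close>

lemma vector_derivative_eq_if_differ_by_const:
  fixes F G :: "real \<Rightarrow> 'a::real_normed_vector"
  assumes "open S" "x \<in> S" "\<And>t. t \<in> S \<Longrightarrow> F t = G t + k"
  shows "vector_derivative F (at x) = vector_derivative G (at x)"
proof -
  have transfer: "(G has_vector_derivative d) (at x)"
    if "(F has_vector_derivative d) (at x)" "\<And>t. t \<in> S \<Longrightarrow> G t = F t + k"
    for F G :: "real \<Rightarrow> 'a" and k d
  proof -
    have "((\<lambda>t. F t + k) has_vector_derivative d) (at x)"
      using has_vector_derivative_add[OF that(1) has_vector_derivative_const[of k]] by simp
    then show ?thesis
      using assms(1,2) by (rule has_vector_derivative_transform_within_open) (simp add: that(2))
  qed
  have "(F has_vector_derivative d) (at x) \<longleftrightarrow> (G has_vector_derivative d) (at x)" for d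
    using transfer[of F d G "- k"] transfer[of G d F k] assms(3) by auto
  then show ?thesis
    unfolding vector_derivative_def by simp
qed

lemma wirtinger_dz_eq_if_differ_by_const:
  assumes "open \<Omega>" "z \<in> \<Omega>" "\<And>w. w \<in> \<Omega> \<Longrightarrow> F w = G w + k"
  shows "wirtinger_dz F z = wirtinger_dz G z"
proof -
  have open_lines: "open ((\<lambda>x. Complex x (Im z)) -` \<Omega>)" "open ((\<lambda>y. Complex (Re z) y) -` \<Omega>)"
    using assms(1) by (auto intro!: open_vimage continuous_intros simp: Complex_eq)
  have "vector_derivative (\<lambda>x. F (Complex x (Im z))) (at (Re z)) =
      vector_derivative (\<lambda>x. G (Complex x (Im z))) (at (Re z))"
    by (rule vector_derivative_eq_if_differ_by_const[OF open_lines(1), where k = k])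
      (use assms(2,3) in simp_all)
  moreover have "vector_derivative (\<lambda>y. F (Complex (Re z) y)) (at (Im z)) =
      vector_derivative (\<lambda>y. G (Complex (Re z) y)) (at (Im z))"
    by (rule vector_derivative_eq_if_differ_by_const[OF open_lines(2), where k = k])
      (use assms(2,3) in simp_all)
  ultimately show ?thesis
    by (simp add: wirtinger_dz_def)
qed

lemma pre_schwarzian_sp_affine_comp:
  assumes "open \<Omega>" "z \<in> \<Omega>" "harmonic_decomp \<Omega> f h g" "sense_preserving \<Omega> f" "norm b < norm a"
  shows "pre_schwarzian_sp \<Omega> (affine_harmonic a b c \<circ> f) z = pre_schwarzian_sp \<Omega> f z"
  unfolding pre_schwarzian_sp_def
proof (rule wirtinger_dz_eq_if_differ_by_const[OF assms(1,2)])
  fix w assume w: "w \<in> \<Omega>"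
  have "jacobian \<Omega> f w > 0"
    using assms(4) w by (simp add: sense_preserving_def)
  moreover have "(norm a)\<^sup>2 - (norm b)\<^sup>2 > 0"
    using assms(5) by (simp add: power_strict_mono)
  ultimately show "complex_of_real (ln (jacobian \<Omega> (affine_harmonic a b c \<circ> f) w)) =
      complex_of_real (ln (jacobian \<Omega> f w)) + complex_of_real (ln ((norm a)\<^sup>2 - (norm b)\<^sup>2))"
    by (simp add: jacobian_affine_comp[OF assms(1) w assms(3)] ln_mult_pos)
qed

lemma schwarzian_sp_affine_comp:
  assumes "open \<Omega>" "z \<in> \<Omega>" "harmonic_decomp \<Omega> f h g" "sense_preserving \<Omega> f" "norm b < norm a"
  shows "schwarzian_sp \<Omega> (affine_harmonic a b c \<circ> f) z = schwarzian_sp \<Omega> f z"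
proof -
  have P: "pre_schwarzian_sp \<Omega> (affine_harmonic a b c \<circ> f) w = pre_schwarzian_sp \<Omega> f w"
    if "w \<in> \<Omega>" for w
    using pre_schwarzian_sp_affine_comp assms that by blast
  then have "wirtinger_dz (pre_schwarzian_sp \<Omega> (affine_harmonic a b c \<circ> f)) z =
      wirtinger_dz (pre_schwarzian_sp \<Omega> f) z"
    by (intro wirtinger_dz_eq_if_differ_by_const[OF assms(1,2), where k = 0]) simp
  with P[OF assms(2)] show ?thesis
    by (simp add: schwarzian_sp_def)
qed

theorem proposition1:
  fixes \<Omega> :: "complex set" and f h g :: "complex \<Rightarrow> complex" and a b c :: complex
  assumes "open \<Omega>" and "connected \<Omega>" and "\<Omega> \<noteq> {}" and "simply_connected \<Omega>"
    and "harmonic_decomp \<Omega> f h g"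
    and "sense_preserving \<Omega> f"
    and "norm a \<noteq> norm b"
  shows "(\<forall>z\<in>\<Omega>. pre_schwarzian \<Omega> (affine_harmonic a b c \<circ> f) z = pre_schwarzian \<Omega> f z) \<and>
         (\<forall>z\<in>\<Omega>. schwarzian \<Omega> (affine_harmonic a b c \<circ> f) z = schwarzian \<Omega> f z)"
proof -
  let ?F = "affine_harmonic a b c \<circ> f"
  have decomp: "\<exists>H G. harmonic_decomp \<Omega> ?F H G"
    using harmonic_decomp_affine_comp[OF assms(5)] by blast
  have J_pos: "jacobian \<Omega> f z > 0" if "z \<in> \<Omega>" for z
    using assms(6) that by (simp add: sense_preserving_def)
  note J = jacobian_affine_comp[OF assms(1) _ assms(5), of _ a b c]
  show ?thesis
  proof (cases "norm b < norm a")
    case True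
    then have "(norm a)\<^sup>2 - (norm b)\<^sup>2 > 0"
      by (simp add: power_strict_mono)
    then have "sense_preserving \<Omega> ?F"
      using decomp J J_pos by (simp add: sense_preserving_def)
    with True show ?thesis
      using assms(6) pre_schwarzian_sp_affine_comp[OF assms(1) _ assms(5,6)]
        schwarzian_sp_affine_comp[OF assms(1) _ assms(5,6)]
      by (simp add: pre_schwarzian_def schwarzian_def)
  next
    case False
    with assms(7) have less: "norm (cnj a) < norm (cnj b)"
      by simp
    then have "(norm a)\<^sup>2 - (norm b)\<^sup>2 < 0"
      by (simp add: power_strict_mono)
    then have neg: "jacobian \<Omega> ?F z < 0" if "z \<in> \<Omega>" for z
      using J J_pos that by (simp add: mult_neg_pos)
    have "sense_reversing \<Omega> ?F"
      using decomp neg by (simp add: sense_reversing_def)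
    \<comment> \<open>Over the empty set every mapping would be sense-preserving as well as sense-reversing.\<close>
    moreover have "\<not> sense_preserving \<Omega> ?F"
      using neg assms(3) by (force simp: sense_preserving_def)
    moreover have "cnj \<circ> ?F = affine_harmonic (cnj b) (cnj a) (cnj c) \<circ> f"
      by (metis comp_assoc cnj_comp_affine_harmonic)
    ultimately show ?thesis
      using assms(6) pre_schwarzian_sp_affine_comp[OF assms(1) _ assms(5,6) less]
        schwarzian_sp_affine_comp[OF assms(1) _ assms(5,6) less]
      by (simp add: pre_schwarzian_def schwarzian_def)
  qed
qed

end
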